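(* Let $(\mathcal{X},d)$ be a complete separable metric space, $1<p<\infty$, $\frac1p<\alpha<1$, $\bar x\in\mathcal{X}$, and let $\pi\in P(C([0,T];\mathcal{X}))$ satisfy $$\int_{C([0,T];\mathcal{X})}\Big(d(\gamma_0,\bar x)^p+|\gamma|_{W^{\alpha,p}}^p\Big)\,d\pi(\gamma)<+\infty .$$ Then the curve $t\mapsto\mu_t:=(e_t)_\#\pi$ belongs to $W^{\alpha,p}([0,T];P_p(\mathcal{X}))$, and moreover $$|\mu|_{W^{\alpha,p}}^p\le\int_{C([0,T];\mathcal{X})}|\gamma|_{W^{\alpha,p}}^p\,d\pi(\gamma).$$ The same statement holds (with $T=1$) when $|\cdot|_{W^{\alpha,p}}$ and $W^{\alpha,p}$ are replaced everywhere by $|\cdot|_{b^{\alpha,p}}$ and $b^{\alpha,p}$.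
   Context: $C([0,T];\mathcal{X})$ is the space of continuous paths with the supremum distance and its Borel $\sigma$-algebra; $P(\mathcal{Y})$ denotes Borel probability measures on $\mathcal{Y}$; $e_t(\gamma)=\gamma_t$. $P_p(\mathcal{X})$ is the set of Borel probability measures with finite $p$-th moment, equipped with the $p$-Wasserstein distance $W_p$. For a metric space $(\mathcal{Y},\rho)$, $1<p<\infty$ and $\frac1p<\alpha<1$, and a path $X:[0,T]\to\mathcal{Y}$: $$|X|_{W^{\alpha,p}}=\Big(\iint_{[0,T]^2}\frac{\rho(X_s,X_t)^p}{|t-s|^{1+\alpha p}}\,ds\,dt\Big)^{1/p},$$ and $W^{\alpha,p}([0,T];\mathcal{Y})$ is the set of continuous paths $X$ with $|X|_{W^{\alpha,p}}<\infty$. For $T=1$, $$|X|_{b^{\alpha,p}}=\Big(\sum_{m=0}^\infty 2^{m(\alpha p-1)}\sum_{k=0}^{2^m-1}\rho\big(X_{k/2^m},X_{(k+1)/2^m}\big)^p\Big)^{1/p},$$ and $b^{\alpha,p}([0,1];\mathcal{Y})$ is the set of continuous paths with $|X|_{b^{\alpha,p}}<\infty$. For curves of measures these are taken with $(\mathcal{Y},\rho)=(P_p(\mathcal{X}),W_p)$. *)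

theory Defs
  imports "HOL-Probability.Probability"
begin

text \<open>
  The real power on \<open>[0,\<infinity>]\<close>, for exponents \<open>a > 0\<close>.
\<close>
definition ennpowr :: "ennreal \<Rightarrow> real \<Rightarrow> ennreal" where
  "ennpowr x a = (if x = \<top> then \<top> else ennreal (enn2real x powr a))"

text \<open>
  \<open>C([0,T]; X)\<close> with the supremum distance: paths are functions on \<open>real\<close> which are
  \<open>undefined\<close> outside \<open>{0..T}\<close>, so that a path is determined by its values on \<open>{0..T}\<close>.
\<close>
definition path_space :: "real \<Rightarrow> (real \<Rightarrow> 'a::metric_space) metric" where
  "path_space T = cfunspace (top_of_set {0..T}) euclidean_metric"

definition path_borel :: "real \<Rightarrow> (real \<Rightarrow> 'a::metric_space) measure" where
  "path_borel T = sigma (mspace (path_space T)) {U. openin (mtopology_of (path_space T)) U}"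

lemma mspace_path_space:
  "mspace (path_space T :: (real \<Rightarrow> 'a::metric_space) metric) = {\<gamma> \<in> extensional {0..T}. continuous_on {0..T} \<gamma>}"
proof -
  have "bounded (\<gamma> ` {0..T})" if "continuous_on {0..T} \<gamma>" for \<gamma> :: "real \<Rightarrow> 'a"
    using that by (intro compact_imp_bounded compact_continuous_image) auto
  then show ?thesis
    by (auto simp: path_space_def)
qed

lemma mdist_path_space:
  fixes \<gamma> \<eta> :: "real \<Rightarrow> 'a::metric_space"
  assumes "0 \<le> T" "\<gamma> \<in> mspace (path_space T)" "\<eta> \<in> mspace (path_space T)"
  shows "mdist (path_space T) \<gamma> \<eta> = (SUP t\<in>{0..T}. dist (\<gamma> t) (\<eta> t))"
  using assms cfunspace_subset_funspace[of "top_of_set {0..T}" "euclidean_metric :: 'a metric"]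
  unfolding path_space_def
  by (auto simp add: mdist_cfunspace_eq_mdist_funspace Met_TC.fdist_def Met_TC.fspace_def)

text \<open>
  Below, a metric space \<open>(Y, \<rho>)\<close> is given by its carrier \<open>Y\<close> and its distance \<open>\<rho>\<close>; it is
  instantiated with \<open>(UNIV, dist)\<close> and with the Wasserstein space. A path in \<open>Y\<close> is a function
  on \<open>real\<close> of which only the restriction to \<open>{0..T}\<close> matters.
\<close>
definition continuous_path :: "real \<Rightarrow> 'b set \<Rightarrow> ('b \<Rightarrow> 'b \<Rightarrow> real) \<Rightarrow> (real \<Rightarrow> 'b) \<Rightarrow> bool" where
  "continuous_path T Y \<rho> X \<longleftrightarrow>
     (\<forall>t\<in>{0..T}. X t \<in> Y) \<and>
     (\<forall>t\<in>{0..T}. \<forall>\<epsilon>>0. \<exists>\<delta>>0. \<forall>s\<in>{0..T}. \<bar>s - t\<bar> < \<delta> \<longrightarrow> \<rho> (X s) (X t) < \<epsilon>)"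

text \<open>
  On the diagonal \<open>s = t\<close>, a null set, the integrand is \<open>0\<close> because \<open>x / 0 = 0\<close>.
\<close>
definition sobolev_seminorm ::
    "real \<Rightarrow> real \<Rightarrow> real \<Rightarrow> ('b \<Rightarrow> 'b \<Rightarrow> real) \<Rightarrow> (real \<Rightarrow> 'b) \<Rightarrow> ennreal" where
  "sobolev_seminorm \<alpha> p T \<rho> X =
     ennpowr
       (\<integral>\<^sup>+ z \<in> {0..T} \<times> {0..T}.
          ennreal (\<rho> (X (fst z)) (X (snd z)) powr p / \<bar>snd z - fst z\<bar> powr (1 + \<alpha> * p))
        \<partial>(lborel :: (real \<times> real) measure))
       (1 / p)"

definition sobolev_paths ::
    "real \<Rightarrow> real \<Rightarrow> real \<Rightarrow> 'b set \<Rightarrow> ('b \<Rightarrow> 'b \<Rightarrow> real) \<Rightarrow> (real \<Rightarrow> 'b) set" where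
  "sobolev_paths \<alpha> p T Y \<rho> =
     {X. continuous_path T Y \<rho> X \<and> sobolev_seminorm \<alpha> p T \<rho> X < \<top>}"

definition besov_seminorm ::
    "real \<Rightarrow> real \<Rightarrow> ('b \<Rightarrow> 'b \<Rightarrow> real) \<Rightarrow> (real \<Rightarrow> 'b) \<Rightarrow> ennreal" where
  "besov_seminorm \<alpha> p \<rho> X =
     ennpowr
       (\<Sum>m. ennreal (2 powr (real m * (\<alpha> * p - 1))) *
          (\<Sum>k<2 ^ m. ennreal (\<rho> (X (real k / 2 ^ m)) (X (real (k + 1) / 2 ^ m)) powr p)))
       (1 / p)"

definition besov_paths ::
    "real \<Rightarrow> real \<Rightarrow> 'b set \<Rightarrow> ('b \<Rightarrow> 'b \<Rightarrow> real) \<Rightarrow> (real \<Rightarrow> 'b) set" where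
  "besov_paths \<alpha> p Y \<rho> =
     {X. continuous_path 1 Y \<rho> X \<and> besov_seminorm \<alpha> p \<rho> X < \<top>}"

definition wasserstein_space :: "real \<Rightarrow> 'a::metric_space measure set" where
  "wasserstein_space p =
     {\<mu> \<in> space (prob_algebra borel). \<exists>x\<^sub>0. (\<integral>\<^sup>+ x. ennreal (dist x x\<^sub>0 powr p) \<partial>\<mu>) < \<top>}"

definition couplings :: "'a::metric_space measure \<Rightarrow> 'a measure \<Rightarrow> ('a \<times> 'a) measure set" where
  "couplings \<mu> \<nu> =
     {\<sigma> \<in> space (prob_algebra borel). distr \<sigma> borel fst = \<mu> \<and> distr \<sigma> borel snd = \<nu>}"

text \<open>
  The infimum is finite for measures in \<open>wasserstein_space p\<close>, so \<open>enn2real\<close> loses nothing there.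
\<close>
definition wasserstein_dist :: "real \<Rightarrow> 'a::metric_space measure \<Rightarrow> 'a measure \<Rightarrow> real" where
  "wasserstein_dist p \<mu> \<nu> =
     enn2real (ennpowr
       (INF \<sigma>\<in>couplings \<mu> \<nu>. \<integral>\<^sup>+ z. ennreal (dist (fst z) (snd z) powr p) \<partial>\<sigma>) (1 / p))"

text \<open>The curve \<open>t \<mapsto> (e\<^sub>t)\<^sub># \<pi>\<close>, meaningful for \<open>t\<close> in \<open>{0..T}\<close>.\<close>
definition marginal_curve :: "(real \<Rightarrow> 'a::metric_space) measure \<Rightarrow> real \<Rightarrow> 'a measure" where
  "marginal_curve \<pi> t = distr \<pi> borel (\<lambda>\<gamma>. \<gamma> t)"

end

theory Submission
  imports Defs
begin

text \<open>
  The joint law of \<open>(\<gamma> s, \<gamma> t)\<close> under \<open>\<pi>\<close> is a coupling of \<open>\<mu>\<^sub>s\<close> and \<open>\<mu>\<^sub>t\<close>, so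
  \<open>W\<^sub>p(\<mu>\<^sub>s, \<mu>\<^sub>t)\<^sup>p\<close> is at most the \<open>\<pi>\<close>-integral of \<open>d(\<gamma> s, \<gamma> t)\<^sup>p\<close>; exchanging integrals gives
  both seminorm inequalities. Since \<open>\<alpha> > 1 / p\<close>, each seminorm also bounds the supremum of
  \<open>d(\<gamma> 0, \<gamma> t)\<close> linearly: by chaining over dyadic points in the Besov case, and by chaining averages
  over intervals shrinking to \<open>t\<close> in the Sobolev case. Hence \<open>d(\<gamma> s, \<gamma> t)\<^sup>p\<close> has a \<open>\<pi>\<close>-integrable
  majorant, so the \<open>p\<close>-th moments are finite, and continuity of \<open>\<mu>\<close> follows by dominated convergence.
\<close>

section \<open>Powers on [0, infinity] and the Wasserstein cost of a single coupling\<close>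

lemma ennpowr_inverse:
  assumes "0 < p"
  shows "ennpowr (ennpowr x (1 / p)) p = x"
  using assms by (cases x) (auto simp: ennpowr_def powr_powr)

lemma ennpowr_less_top_iff: "ennpowr x a < \<top> \<longleftrightarrow> x < \<top>"
  by (auto simp: ennpowr_def top.not_eq_extremum)

lemma wasserstein_dist_powr_le:
  assumes "0 < p" "\<sigma> \<in> couplings \<mu> \<nu>"
  shows "ennreal (wasserstein_dist p \<mu> \<nu> powr p) \<le> (\<integral>\<^sup>+ z. ennreal (dist (fst z) (snd z) powr p) \<partial>\<sigma>)"
proof -
  define I where "I = (INF \<sigma>\<in>couplings \<mu> \<nu>. \<integral>\<^sup>+ z. ennreal (dist (fst z) (snd z) powr p) \<partial>\<sigma>)"
  \<comment> \<open>If \<open>I\<close> is infinite, \<open>enn2real\<close> sends the distance to 0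
    and the bound is trivial; otherwise \<open>powr p\<close> undoes the root.\<close>
  have "ennreal (wasserstein_dist p \<mu> \<nu> powr p) \<le> I"
    using assms(1) unfolding wasserstein_dist_def I_def[symmetric]
    by (cases I) (auto simp: ennpowr_def powr_powr)
  also have "I \<le> (\<integral>\<^sup>+ z. ennreal (dist (fst z) (snd z) powr p) \<partial>\<sigma>)"
    unfolding I_def using assms(2) by (rule INF_lower)
  finally show ?thesis .
qed

subsection \<open>Measurability of evaluation\<close>

lemma
  shows space_path_borel: "space (path_borel T) = mspace (path_space T)"
    and sets_path_borel:
      "sets (path_borel T) = sigma_sets (mspace (path_space T)) {U. openin (mtopology_of (path_space T)) U}"
proof -
  have "{U. openin (mtopology_of (path_space T)) U} \<subseteq> Pow (mspace (path_space T))"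
    by (auto dest!: openin_subset)
  from space_measure_of[OF this] sets_measure_of[OF this]
  show "space (path_borel T) = mspace (path_space T)"
    and "sets (path_borel T) = sigma_sets (mspace (path_space T)) {U. openin (mtopology_of (path_space T)) U}"
    by (simp_all only: path_borel_def)
qed

lemma continuous_on_path:
  assumes "\<gamma> \<in> space (path_borel T)"
  shows "continuous_on {0..T} \<gamma>"
  using assms by (simp add: space_path_borel mspace_path_space)

text \<open>The distance of paths is a real supremum, so each value lies below it only once the
  family is bounded above; continuity on the compact interval supplies this.\<close>

lemma dist_le_mdist_path_space:
  fixes \<gamma> \<eta> :: "real \<Rightarrow> 'a::metric_space"
  assumes "\<gamma> \<in> mspace (path_space T)" "\<eta> \<in> mspace (path_space T)" "t \<in> {0..T}"
  shows "dist (\<gamma> t) (\<eta> t) \<le> mdist (path_space T) \<gamma> \<eta>"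
proof -
  have "continuous_on {0..T} (\<lambda>t. dist (\<gamma> t) (\<eta> t))"
    using assms by (auto simp: mspace_path_space intro!: continuous_intros)
  then have "bdd_above ((\<lambda>t. dist (\<gamma> t) (\<eta> t)) ` {0..T})"
    by (intro bounded_imp_bdd_above compact_imp_bounded compact_continuous_image) auto
  then show ?thesis
    using assms by (subst mdist_path_space) (auto intro!: cSUP_upper)
qed

text \<open>Evaluation at a fixed time is 1-Lipschitz for the supremum distance, so preimages of
  open sets are open: a radius that fits around \<open>\<gamma> t\<close> also fits around \<gamma>
  in the preimage.\<close>

lemma measurable_path_eval:
  fixes t :: real
  assumes "t \<in> {0..T}"
  shows "(\<lambda>\<gamma>. \<gamma> t) \<in> path_borel T \<rightarrow>\<^sub>M (borel :: 'a::metric_space measure)"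
proof (rule borel_measurableI)
  fix S :: "'a set" assume S: "open S"
  let ?P = "path_space T :: (real \<Rightarrow> 'a) metric"
  have "openin (mtopology_of ?P) {\<gamma> \<in> mspace ?P. \<gamma> t \<in> S}"
    unfolding mtopology_of_def Metric_space.openin_mtopology[OF Metric_space_mspace_mdist]
  proof (intro conjI allI impI)
    fix \<gamma> assume \<gamma>: "\<gamma> \<in> {\<gamma> \<in> mspace ?P. \<gamma> t \<in> S}"
    then obtain r where r: "0 < r" "ball (\<gamma> t) r \<subseteq> S"
      using S open_contains_ball by blast
    have "Metric_space.mball (mspace ?P) (mdist ?P) \<gamma> r \<subseteq> {\<gamma> \<in> mspace ?P. \<gamma> t \<in> S}"
    proof
      fix \<eta> assume "\<eta> \<in> Metric_space.mball (mspace ?P) (mdist ?P) \<gamma> r"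
      then have \<eta>: "\<eta> \<in> mspace ?P" "mdist ?P \<gamma> \<eta> < r"
        by (auto simp: Metric_space.in_mball[OF Metric_space_mspace_mdist])
      then have "dist (\<gamma> t) (\<eta> t) < r"
        using dist_le_mdist_path_space[of \<gamma> T \<eta> t] \<gamma> assms by auto
      then show "\<eta> \<in> {\<gamma> \<in> mspace ?P. \<gamma> t \<in> S}"
        using \<eta> r by auto
    qed
    with r show "\<exists>r>0. Metric_space.mball (mspace ?P) (mdist ?P) \<gamma> r \<subseteq> {\<gamma> \<in> mspace ?P. \<gamma> t \<in> S}"
      by blast
  qed auto
  then have "{\<gamma> \<in> mspace ?P. \<gamma> t \<in> S} \<in> sets (path_borel T)"
    unfolding sets_path_borel by (blast intro: sigma_sets.Basic)
  moreover have "(\<lambda>\<gamma>. \<gamma> t) -` S \<inter> space (path_borel T) = {\<gamma> \<in> mspace ?P. \<gamma> t \<in> S}"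
    by (auto simp: space_path_borel)
  ultimately show "(\<lambda>\<gamma>. \<gamma> t) -` S \<inter> space (path_borel T) \<in> sets (path_borel T)"
    by simp
qed

text \<open>Time is clamped to [0,T] because paths are \<open>undefined\<close> elsewhere. Rounding
  time down to a grid of mesh 1/(n+1) leaves countably many fixed-time evaluations, and continuity
  of the path recovers the value in the limit. Exchanging integrals in the Sobolev case rests on
  this joint measurability.\<close>

lemma measurable_path_eval_joint:
  assumes "0 < T"
  shows "(\<lambda>(\<gamma>, s). \<gamma> (max 0 (min T s))) \<in> path_borel T \<Otimes>\<^sub>M borel \<rightarrow>\<^sub>M (borel :: 'a::metric_space measure)"
proof (rule borel_measurable_LIMSEQ_metric)
  let ?c = "\<lambda>n i. max 0 (min T (real_of_int i / real (Suc n)))"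
  fix n
  have "(\<lambda>z. fst z (?c n i)) \<in> path_borel T \<Otimes>\<^sub>M borel \<rightarrow>\<^sub>M (borel :: 'a measure)" for i
    using assms by (intro measurable_compose[OF measurable_fst measurable_path_eval]) auto
  moreover have "(\<lambda>z. \<lfloor>snd z * real (Suc n)\<rfloor>) \<in> (path_borel T :: (real \<Rightarrow> 'a) measure) \<Otimes>\<^sub>M borel \<rightarrow>\<^sub>M count_space UNIV"
    by measurable
  ultimately show "(\<lambda>z. fst z (?c n \<lfloor>snd z * real (Suc n)\<rfloor>)) \<in> path_borel T \<Otimes>\<^sub>M borel \<rightarrow>\<^sub>M (borel :: 'a measure)"
    by (rule measurable_compose_countable)
next
  fix z :: "(real \<Rightarrow> 'a) \<times> real" assume "z \<in> space (path_borel T \<Otimes>\<^sub>M borel)"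
  then have cont: "continuous_on {0..T} (fst z)"
    by (auto simp: space_pair_measure intro: continuous_on_path)
  let ?s = "snd z"
  have "(\<lambda>n. real_of_int \<lfloor>?s * real (Suc n)\<rfloor> / real (Suc n)) \<longlonglongrightarrow> ?s"
    by real_asymp
  then have "(\<lambda>n. max 0 (min T (real_of_int \<lfloor>?s * real (Suc n)\<rfloor> / real (Suc n)))) \<longlonglongrightarrow> max 0 (min T ?s)"
    by (intro tendsto_intros)
  then have "(\<lambda>n. fst z (max 0 (min T (real_of_int \<lfloor>?s * real (Suc n)\<rfloor> / real (Suc n))))) \<longlonglongrightarrow> fst z (max 0 (min T ?s))"
    using assms by (intro continuous_on_tendsto_compose[OF cont]) auto
  then show "(\<lambda>n. fst z (max 0 (min T (real_of_int \<lfloor>snd z * real (Suc n)\<rfloor> / real (Suc n)))))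
        \<longlonglongrightarrow> (case z of (\<gamma>, s) \<Rightarrow> \<gamma> (max 0 (min T s)))"
    by (simp add: case_prod_beta)
qed

subsection \<open>Supremum bound by the Besov seminorm\<close>

text \<open>A single term of the double series is at most the whole series. Taking p-th roots then
  gives geometric decay in the level m, which is what chaining can sum.\<close>

lemma besov_seminorm_increment:
  fixes X :: "real \<Rightarrow> 'a::metric_space"
  assumes "0 < p" "0 < B" "ennpowr (besov_seminorm \<alpha> p dist X) p \<le> ennreal (B powr p)" "k < 2 ^ m"
  shows "dist (X (real k / 2 ^ m)) (X (real (k + 1) / 2 ^ m)) \<le> B * (2 powr - (\<alpha> - 1 / p)) ^ m"
proof -
  let ?d = "\<lambda>m k. dist (X (real k / 2 ^ m)) (X (real (k + 1) / 2 ^ m))"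
  let ?S = "\<lambda>m. ennreal (2 powr (real m * (\<alpha> * p - 1))) * (\<Sum>k<2 ^ m. ennreal (?d m k powr p))"
  have "ennreal (2 powr (real m * (\<alpha> * p - 1)) * ?d m k powr p)
      = ennreal (2 powr (real m * (\<alpha> * p - 1))) * ennreal (?d m k powr p)"
    by (simp add: ennreal_mult)
  also have "ennreal (?d m k powr p) \<le> (\<Sum>k<2 ^ m. ennreal (?d m k powr p))"
    by (rule member_le_sum[of k]) (use assms in auto)
  then have "ennreal (2 powr (real m * (\<alpha> * p - 1))) * ennreal (?d m k powr p) \<le> ?S m"
    by (rule mult_left_mono) simp
  also have "?S m \<le> (\<Sum>m. ?S m)"
    using sum_le_suminf[of ?S "{m}"] by simp
  also have "\<dots> \<le> ennreal (B powr p)"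
    using assms by (simp add: besov_seminorm_def ennpowr_inverse)
  finally have "2 powr (real m * (\<alpha> * p - 1)) * ?d m k powr p \<le> B powr p"
    using assms by (subst (asm) ennreal_le_iff) auto
  \<comment> \<open>Since m(\<alpha>p - 1) = p m(\<alpha> - 1/p), weight and increment form one p-th
    power, so the root can be taken.\<close>
  moreover have "2 powr (real m * (\<alpha> * p - 1)) * ?d m k powr p
      = (2 powr (real m * (\<alpha> - 1 / p)) * ?d m k) powr p"
    using assms by (simp add: powr_mult powr_powr mult.assoc left_diff_distrib)
  ultimately have "2 powr (real m * (\<alpha> - 1 / p)) * ?d m k \<le> B"
    using assms powr_less_mono2[of p B "2 powr (real m * (\<alpha> - 1 / p)) * ?d m k"] by linarith
  then have "?d m k \<le> B / 2 powr (real m * (\<alpha> - 1 / p))"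
    by (simp add: field_simps)
  also have "\<dots> = B * (2 powr - (\<alpha> - 1 / p)) ^ m"
  proof -
    have "(2 powr - (\<alpha> - 1 / p)) ^ m = 2 powr (- (real m * (\<alpha> - 1 / p)))"
      by (simp add: powr_power right_diff_distrib)
    then show ?thesis
      by (simp only: powr_minus divide_inverse)
  qed
  finally show ?thesis .
qed

text \<open>Induction on the level: an even numerator gives a point of the previous level, and an
  odd one, 2j + 1, lies one increment of the new level to the right of j / 2^n. Each level is thus
  paid for at most once.\<close>

lemma dyadic_chaining:
  fixes X :: "real \<Rightarrow> 'a::metric_space"
  assumes "\<And>m k. k < 2 ^ m \<Longrightarrow> dist (X (real k / 2 ^ m)) (X (real (k + 1) / 2 ^ m)) \<le> c m"
    and "\<And>m. 0 \<le> c m" "k \<le> 2 ^ n"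
  shows "dist (X 0) (X (real k / 2 ^ n)) \<le> (\<Sum>m\<le>n. c m)"
  using \<open>k \<le> 2 ^ n\<close>
proof (induction n arbitrary: k)
  case 0
  then have "k = 0 \<or> k = 1" by auto
  with assms(1)[of 0 0] assms(2)[of 0] show ?case by auto
next
  case (Suc n)
  show ?case
  proof (cases "even k")
    case True
    then obtain j where "k = 2 * j" by auto
    then show ?thesis
      using Suc.IH[of j] Suc.prems assms(2)[of "Suc n"] by simp
  next
    case False
    then obtain j where j: "k = 2 * j + 1" by (auto elim: oddE)
    with Suc.prems have less: "2 * j < 2 ^ Suc n" by simp
    have "dist (X 0) (X (real k / 2 ^ Suc n)) \<le> dist (X 0) (X (real j / 2 ^ n))
        + dist (X (real (2 * j) / 2 ^ Suc n)) (X (real (2 * j + 1) / 2 ^ Suc n))"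
      using dist_triangle[of "X 0" _ "X (real j / 2 ^ n)"] j by simp
    also have "\<dots> \<le> (\<Sum>m\<le>n. c m) + c (Suc n)"
      using less by (intro add_mono Suc.IH assms(1)) auto
    finally show ?thesis by simp
  qed
qed

text \<open>Chaining reaches the dyadic points floor(t 2^n) / 2^n at a cost below the geometric
  series of ratio 2^-(\<alpha> - 1/p), which is less than 1 because \<alpha> > 1/p. These points
  tend to t, and continuity carries the bound over.\<close>

lemma besov_sup_bound:
  fixes X :: "real \<Rightarrow> 'a::metric_space"
  assumes "1 < p" "1 / p < \<alpha>" "0 < B" "continuous_on {0..1} X" "t \<in> {0..1}"
    and "ennpowr (besov_seminorm \<alpha> p dist X) p \<le> ennreal (B powr p)"
  shows "dist (X 0) (X t) \<le> 1 / (1 - 2 powr - (\<alpha> - 1 / p)) * B"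
proof (rule LIMSEQ_le_const2)
  define r where "r = 2 powr - (\<alpha> - 1 / p)"
  have r: "0 < r" "r < 1"
    using assms powr_less_mono[of "- (\<alpha> - 1 / p)" 0 2] by (auto simp: r_def)
  have nn: "nat \<lfloor>t * 2 ^ n\<rfloor> \<le> 2 ^ n" for n
  proof -
    have "t * 2 ^ n \<le> 2 ^ n" using assms(5) by simp
    then have "\<lfloor>t * 2 ^ n\<rfloor> \<le> \<lfloor>2 ^ n :: real\<rfloor>" by (rule floor_mono)
    then show ?thesis by (simp add: nat_le_iff floor_power)
  qed
  have eq: "real (nat \<lfloor>t * 2 ^ n\<rfloor>) = real_of_int \<lfloor>t * 2 ^ n\<rfloor>" for n
    using assms(5) by simp
  have "(\<lambda>n. real_of_int \<lfloor>t * 2 ^ n\<rfloor> / 2 ^ n) \<longlonglongrightarrow> t"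
    by real_asymp
  then have lim: "(\<lambda>n. real (nat \<lfloor>t * 2 ^ n\<rfloor>) / 2 ^ n) \<longlonglongrightarrow> t"
    by (simp only: eq)
  moreover have "real (nat \<lfloor>t * 2 ^ n\<rfloor>) / 2 ^ n \<in> {0..1}" for n
  proof -
    have "real (nat \<lfloor>t * 2 ^ n\<rfloor>) \<le> 2 ^ n"
      using nn[of n] by (metis of_nat_le_iff of_nat_numeral of_nat_power)
    then show ?thesis by simp
  qed
  ultimately show "(\<lambda>n. dist (X 0) (X (real (nat \<lfloor>t * 2 ^ n\<rfloor>) / 2 ^ n))) \<longlonglongrightarrow> dist (X 0) (X t)"
    using assms by (intro tendsto_intros continuous_on_tendsto_compose[OF assms(4)]) auto
  have "dist (X 0) (X (real (nat \<lfloor>t * 2 ^ n\<rfloor>) / 2 ^ n)) \<le> 1 / (1 - r) * B" for n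
  proof -
    have "dist (X 0) (X (real (nat \<lfloor>t * 2 ^ n\<rfloor>) / 2 ^ n)) \<le> (\<Sum>m\<le>n. B * r ^ m)"
      using assms nn r unfolding r_def by (intro dyadic_chaining besov_seminorm_increment) auto
    also have "\<dots> = B * (\<Sum>m\<le>n. r ^ m)" by (simp add: sum_distrib_left)
    also have "(\<Sum>m\<le>n. r ^ m) \<le> (\<Sum>m. r ^ m)"
      using r by (intro sum_le_suminf) (auto intro: summable_geometric)
    also have "\<dots> = 1 / (1 - r)" using r by (intro suminf_geometric) auto
    finally show ?thesis using assms by (simp add: mult.commute mult_left_mono)
  qed
  then show "\<exists>N. \<forall>n\<ge>N. dist (X 0) (X (real (nat \<lfloor>t * 2 ^ n\<rfloor>) / 2 ^ n)) \<le> 1 / (1 - 2 powr - (\<alpha> - 1 / p)) * B"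
    by (auto simp: r_def)
qed

subsection \<open>Supremum bound by the Sobolev seminorm\<close>

text \<open>Tonelli for a product of functions, phrased for \<open>lborel\<close> on pairs because
  the Sobolev seminorm integrates against that measure.\<close>

lemma nn_integral_lborel_times:
  fixes f g :: "real \<Rightarrow> ennreal"
  assumes [measurable]: "f \<in> borel_measurable borel" "g \<in> borel_measurable borel"
  shows "(\<integral>\<^sup>+ z. f (fst z) * g (snd z) \<partial>(lborel :: (real \<times> real) measure))
       = (\<integral>\<^sup>+ x. f x \<partial>lborel) * (\<integral>\<^sup>+ y. g y \<partial>lborel)"
proof -
  have "(\<integral>\<^sup>+ z. f (fst z) * g (snd z) \<partial>(lborel :: (real \<times> real) measure))
      = (\<integral>\<^sup>+ z. f (fst z) * g (snd z) \<partial>(lborel \<Otimes>\<^sub>M lborel))"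
    by (simp add: lborel_prod)
  also have "\<dots> = (\<integral>\<^sup>+ x. \<integral>\<^sup>+ y. f x * g y \<partial>lborel \<partial>lborel)"
    by (subst lborel.nn_integral_fst[symmetric]) auto
  also have "\<dots> = (\<integral>\<^sup>+ x. f x \<partial>lborel) * (\<integral>\<^sup>+ y. g y \<partial>lborel)"
    by (simp add: nn_integral_cmult nn_integral_multc)
  finally show ?thesis .
qed

text \<open>Either d is below the threshold \<epsilon>, or d = d^(1-p) d^p with d^(1-p) \<le>
  \<epsilon>^(1-p), as 1 - p is negative; the factor (h/w)^a is at least 1. This elementary
  splitting takes the place of Hoelder's inequality when a first power of the distance has to be
  bounded by the Sobolev integrand.\<close>

lemma le_add_powr_quotient:
  fixes d \<epsilon> p a h w :: real
  assumes "0 \<le> d" "0 < \<epsilon>" "1 < p" "0 < a" "0 < w" "w \<le> h"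
  shows "d \<le> \<epsilon> + \<epsilon> powr (1 - p) * h powr a * (d powr p / w powr a)"
proof (cases "d \<le> \<epsilon>")
  case True
  then show ?thesis by (rule order_trans) simp
next
  case False
  have "w powr a \<le> h powr a"
    using assms by (intro powr_mono2) auto
  then have "1 \<le> h powr a / w powr a"
    using assms by simp
  have "d = d powr (1 - p) * d powr p"
    using False assms by (simp add: powr_add[symmetric])
  also have "\<dots> \<le> \<epsilon> powr (1 - p) * d powr p"
    using False assms by (intro mult_right_mono powr_mono2') auto
  also have "\<dots> \<le> \<epsilon> powr (1 - p) * d powr p * (h powr a / w powr a)"
    using mult_left_mono[OF \<open>1 \<le> h powr a / w powr a\<close>, of "\<epsilon> powr (1 - p) * d powr p"] by simp
  finally show ?thesis
    using assms by (simp add: mult_ac)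
qed

text \<open>A metric space has no averages of points, so the distance to a fixed point
  \<open>y\<close> is averaged instead. Values in [0, infinity] avoid integrability
  conditions.\<close>

definition interval_average :: "(real \<Rightarrow> 'a::metric_space) \<Rightarrow> 'a \<Rightarrow> real \<Rightarrow> real \<Rightarrow> ennreal" where
  "interval_average Y y a b = ennreal (1 / (b - a)) * (\<integral>\<^sup>+ u\<in>{a..b}. ennreal (dist (Y u) y) \<partial>lborel)"

lemma interval_average_le:
  assumes "a < b" "0 \<le> c" "\<And>u. u \<in> {a..b} \<Longrightarrow> dist (Y u) y \<le> c"
  shows "interval_average Y y a b \<le> ennreal c"
proof -
  have "(\<integral>\<^sup>+ u\<in>{a..b}. ennreal (dist (Y u) y) \<partial>lborel) \<le> (\<integral>\<^sup>+ u\<in>{a..b}. ennreal c \<partial>lborel)"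
    using assms by (intro nn_integral_mono) (auto simp: indicator_def)
  also have "\<dots> = ennreal (c * (b - a))"
    using assms by (simp add: nn_integral_cmult_indicator ennreal_mult)
  finally have "interval_average Y y a b \<le> ennreal (1 / (b - a)) * ennreal (c * (b - a))"
    unfolding interval_average_def by (rule mult_left_mono) simp
  also have "\<dots> = ennreal c"
    using assms by (simp add: ennreal_mult[symmetric])
  finally show ?thesis .
qed

text \<open>Integrate d(Y u, y) \<le> d(Y u, Y v) + d(Y v, y) over u in the large and v in the small
  interval, bound the middle term by \<open>le_add_powr_quotient\<close> with h = b - a, and divide
  by the area. The threshold \<epsilon> stays free, to be adapted to the scale.\<close>

lemma interval_average_step:
  fixes Y :: "real \<Rightarrow> 'a::metric_space"
  defines "Q \<equiv> \<lambda>r p z. ennreal (dist (Y (fst z)) (Y (snd z)) powr p / \<bar>snd z - fst z\<bar> powr r)"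
  assumes "continuous_on UNIV Y" "1 < p" "0 < r" "0 < \<epsilon>"
    and "a \<le> a'" "a' < b'" "b' \<le> b" "{a..b} \<times> {a..b} \<subseteq> S" "S \<in> sets borel"
  shows "interval_average Y y a b \<le> ennreal \<epsilon>
      + ennreal (\<epsilon> powr (1 - p) * (b - a) powr r / ((b - a) * (b' - a'))) * (\<integral>\<^sup>+ z\<in>S. Q r p z \<partial>(lborel :: (real \<times> real) measure))
      + interval_average Y y a' b'"
proof -
  let ?I = "\<lambda>a b. \<integral>\<^sup>+ u\<in>{a..b}. ennreal (dist (Y u) y) \<partial>lborel"
  let ?R = "{a..b} \<times> {a'..b'}"
  let ?K = "\<epsilon> powr (1 - p) * (b - a) powr r"
  let ?c = "1 / ((b - a) * (b' - a'))"
  let ?A = "\<integral>\<^sup>+ z\<in>S. Q r p z \<partial>(lborel :: (real \<times> real) measure)"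
  have [measurable]: "(\<lambda>u. dist (Y u) y) \<in> borel_measurable borel"
    "(\<lambda>z. dist (Y (fst z)) y) \<in> borel_measurable (borel :: (real \<times> real) measure)"
    "(\<lambda>z. dist (Y (snd z)) y) \<in> borel_measurable (borel :: (real \<times> real) measure)"
    "(\<lambda>z. dist (Y (fst z)) (Y (snd z))) \<in> borel_measurable (borel :: (real \<times> real) measure)"
    by (intro borel_measurable_continuous_onI continuous_intros
        continuous_on_compose2[OF \<open>continuous_on UNIV Y\<close>]; simp)+
  have [measurable]: "?R \<in> sets borel" "S \<in> sets borel"
    using assms by (auto intro: borel_Times)
  have [measurable]: "Q r p \<in> borel_measurable borel" "fst \<in> borel_measurable (borel :: (real \<times> real) measure)"
    "snd \<in> borel_measurable (borel :: (real \<times> real) measure)"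
  proof -
    have [measurable]: "fst \<in> borel_measurable (borel :: (real \<times> real) measure)"
      "snd \<in> borel_measurable (borel :: (real \<times> real) measure)"
      by (intro borel_measurable_continuous_onI continuous_intros)+
    show "Q r p \<in> borel_measurable borel" "fst \<in> borel_measurable (borel :: (real \<times> real) measure)"
      "snd \<in> borel_measurable (borel :: (real \<times> real) measure)"
      unfolding Q_def by measurable
  qed
  \<comment> \<open>The length of the small interval is the integral of its indicator, so the left
    side is an integral over the rectangle \<open>?R\<close>.\<close>
  have "?I a b * ennreal (b' - a')
      = (\<integral>\<^sup>+ z. (ennreal (dist (Y (fst z)) y) * indicator {a..b} (fst z)) * indicator {a'..b'} (snd z) \<partial>lborel)"
    using assms by (subst nn_integral_lborel_times) auto
  also have "\<dots> \<le> (\<integral>\<^sup>+ z. ennreal \<epsilon> * indicator ?R z + ennreal ?K * (Q r p z * indicator S z)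
      + indicator {a..b} (fst z) * (ennreal (dist (Y (snd z)) y) * indicator {a'..b'} (snd z)) \<partial>lborel)"
  proof (rule nn_integral_mono)
    fix z :: "real \<times> real"
    obtain u v where z: "z = (u, v)" by force
    show "(ennreal (dist (Y (fst z)) y) * indicator {a..b} (fst z)) * indicator {a'..b'} (snd z)
      \<le> ennreal \<epsilon> * indicator ?R z + ennreal ?K * (Q r p z * indicator S z)
      + indicator {a..b} (fst z) * (ennreal (dist (Y (snd z)) y) * indicator {a'..b'} (snd z))"
    proof (cases "z \<in> ?R")
      case True
      then have S: "z \<in> S" using assms by auto
      have "dist (Y u) (Y v) \<le> \<epsilon> + ?K * (dist (Y u) (Y v) powr p / \<bar>v - u\<bar> powr r)"
      \<comment> \<open>Off the diagonal, 0 < |v - u| \<le> b - a because the intervals are nested;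
        on it the distance is 0.\<close>
      proof (cases "u = v")
        case False
        then show ?thesis
          using True assms z by (intro le_add_powr_quotient) auto
      qed (use assms in simp)
      then have "dist (Y u) y \<le> \<epsilon> + ?K * (dist (Y u) (Y v) powr p / \<bar>v - u\<bar> powr r) + dist (Y v) y"
        using dist_triangle[of "Y u" y "Y v"] by linarith
      then have "ennreal (dist (Y u) y)
          \<le> ennreal (\<epsilon> + ?K * (dist (Y u) (Y v) powr p / \<bar>v - u\<bar> powr r) + dist (Y v) y)"
        by (rule ennreal_leI)
      also have "\<dots> = ennreal \<epsilon> + ennreal ?K * Q r p z + ennreal (dist (Y v) y)"
        using assms z by (simp add: Q_def ennreal_mult[symmetric])
      finally show ?thesis
        using True S z by simp
    qed (use z in \<open>auto simp: indicator_def\<close>)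
  qed
  also have "\<dots> = (\<integral>\<^sup>+ z. ennreal \<epsilon> * indicator ?R z \<partial>lborel) + (\<integral>\<^sup>+ z. ennreal ?K * (Q r p z * indicator S z) \<partial>lborel)
      + (\<integral>\<^sup>+ z. indicator {a..b} (fst z) * (ennreal (dist (Y (snd z)) y) * indicator {a'..b'} (snd z)) \<partial>lborel)"
  proof -
    have [measurable]: "(\<lambda>z. indicator {a..b} (fst z) * (ennreal (dist (Y (snd z)) y) * indicator {a'..b'} (snd z)))
        \<in> borel_measurable (borel :: (real \<times> real) measure)"
      by measurable
    show ?thesis
      by (rule trans[OF nn_integral_add arg_cong2[where f = "(+)", OF nn_integral_add refl]]) measurable
  qed
  also have "(\<integral>\<^sup>+ z. ennreal \<epsilon> * indicator ?R z \<partial>lborel) = ennreal \<epsilon> * emeasure lborel ?R"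
    by (rule nn_integral_cmult_indicator) simp
  also have "(\<integral>\<^sup>+ z. ennreal ?K * (Q r p z * indicator S z) \<partial>lborel) = ennreal ?K * ?A"
    by (rule nn_integral_cmult) measurable
  also have "(\<integral>\<^sup>+ z. indicator {a..b} (fst z) * (ennreal (dist (Y (snd z)) y) * indicator {a'..b'} (snd z)) \<partial>(lborel :: (real \<times> real) measure))
      = ennreal (b - a) * ?I a' b'"
    using assms(6-8) by (subst nn_integral_lborel_times) auto
  also have "emeasure lborel ?R = ennreal ((b - a) * (b' - a'))"
    using assms(6-8) by (simp add: lborel_prod[symmetric] lborel.emeasure_pair_measure_Times ennreal_mult)
  \<comment> \<open>\<open>?c\<close> is the reciprocal of the area of \<open>?R\<close>:
    multiplying by it turns both integrals back into averages and the first error term into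
    \<epsilon>.\<close>
  finally have "ennreal ?c * (?I a b * ennreal (b' - a')) \<le> ennreal ?c * (ennreal \<epsilon> * ennreal ((b - a) * (b' - a'))
      + ennreal ?K * ?A + ennreal (b - a) * ?I a' b')"
    by (rule mult_left_mono) simp
  moreover have "ennreal ?c * (?I a b * ennreal (b' - a')) = interval_average Y y a b"
  proof -
    have "ennreal ?c * (?I a b * ennreal (b' - a')) = (ennreal ?c * ennreal (b' - a')) * ?I a b"
      by (simp only: ac_simps)
    also have "ennreal ?c * ennreal (b' - a') = ennreal (1 / (b - a))"
      using assms by (simp add: ennreal_mult[symmetric])
    finally show ?thesis by (simp add: interval_average_def)
  qed
  moreover have "ennreal ?c * (ennreal (b - a) * ?I a' b') = interval_average Y y a' b'"
  proof -
    have "ennreal ?c * (ennreal (b - a) * ?I a' b') = (ennreal ?c * ennreal (b - a)) * ?I a' b'"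
      by (simp only: ac_simps)
    also have "ennreal ?c * ennreal (b - a) = ennreal (1 / (b' - a'))"
      using assms by (simp add: ennreal_mult[symmetric])
    finally show ?thesis by (simp add: interval_average_def)
  qed
  moreover have "ennreal ?c * (ennreal \<epsilon> * ennreal ((b - a) * (b' - a'))) = ennreal \<epsilon>"
    using assms by (simp add: ennreal_mult[symmetric])
  moreover have "ennreal ?c * (ennreal ?K * ?A) = ennreal (?K / ((b - a) * (b' - a'))) * ?A"
    using assms by (simp add: ennreal_mult[symmetric] mult.assoc[symmetric])
  ultimately show ?thesis
    by (simp only: distrib_left)
qed

text \<open>Averages over intervals halving in length towards t are compared step by step. Passing
  from scale n to n + 1 costs a multiple of B (T / 2^n)^(\<alpha> - 1/p), so the total is a
  geometric series.\<close>

lemma interval_average_bound: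
  fixes Y :: "real \<Rightarrow> 'a::metric_space" and T :: real
  assumes "continuous_on UNIV Y" "1 < p" "1 / p < \<alpha>" "0 < B" "0 < T" "t \<in> {0..T}"
    and A: "ennpowr (sobolev_seminorm \<alpha> p T dist Y) p \<le> ennreal (B powr p)"
  shows "interval_average Y (Y t) 0 T
      \<le> ennreal (3 * T powr (\<alpha> - 1 / p) / (1 - 2 powr - (\<alpha> - 1 / p)) * B)"
proof (rule ennreal_le_epsilon)
  fix e :: real assume "0 < e"
  define \<beta> where "\<beta> = \<alpha> - 1 / p"
  define r where "r = 2 powr - \<beta>"
  \<comment> \<open>Shrinking [0,T] towards t proportionally gives nested intervals of length
    exactly \<open>h n\<close> that contain t and stay in [0,T] even when t is an endpoint; index 0
    gives [0,T] itself.\<close>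
  define lo hi h where "lo n = t - t / 2 ^ n" and "hi n = t + (T - t) / 2 ^ n" and "h n = T / 2 ^ n" for n :: nat
  have \<beta>: "0 < \<beta>" using assms by (simp add: \<beta>_def)
  have r: "0 < r" "r < 1"
    using \<beta> powr_less_mono[of "- \<beta>" 0 2] by (auto simp: r_def)
  have h: "hi n - lo n = h n" "0 < h n" "h (Suc n) = h n / 2" for n
    using assms by (auto simp: lo_def hi_def h_def field_simps)
  have h_powr: "h n powr \<beta> = T powr \<beta> * r ^ n" for n
    using assms by (simp add: h_def r_def powr_divide powr_power powr_minus_divide powr_realpow[symmetric] powr_powr mult.commute)
  have nest: "lo n \<le> lo (Suc n)" "lo (Suc n) \<le> t" "t \<le> hi (Suc n)" "hi (Suc n) \<le> hi n" for n
    using assms by (auto simp: lo_def hi_def field_simps)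
  have t: "lo n \<le> t" "t \<le> hi n" "0 \<le> lo n" "hi n \<le> T" for n
  proof -
    show "lo n \<le> t" "t \<le> hi n" using assms by (auto simp: lo_def hi_def)
    have "t / 2 ^ n \<le> t / 1" "(T - t) / 2 ^ n \<le> (T - t) / 1"
      using assms by (intro divide_left_mono; simp)+
    then show "0 \<le> lo n" "hi n \<le> T" by (auto simp: lo_def hi_def)
  qed
  have step: "interval_average Y (Y t) (lo n) (hi n)
      \<le> ennreal (3 * B * T powr \<beta> * r ^ n) + interval_average Y (Y t) (lo (Suc n)) (hi (Suc n))" for n
  proof -
    \<comment> \<open>This \<open>\<epsilon>\<close> balances the two error terms of the averaging step: both are of order \<open>B * h n powr \<beta>\<close>.\<close>
    let ?\<epsilon> = "B * h n powr \<beta>"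
    let ?A = "\<integral>\<^sup>+ z\<in>{0..T} \<times> {0..T}. ennreal (dist (Y (fst z)) (Y (snd z)) powr p / \<bar>snd z - fst z\<bar> powr (1 + \<alpha> * p))
      \<partial>(lborel :: (real \<times> real) measure)"
    let ?K = "?\<epsilon> powr (1 - p) * (h n) powr (1 + \<alpha> * p) / (h n * h (Suc n))"
    have "0 < \<alpha>" using assms(2,3) by (smt (verit) divide_pos_pos)
    then have "0 < 1 + \<alpha> * p" using assms(2) by (simp add: add_pos_pos)
    then have "interval_average Y (Y t) (lo n) (hi n) \<le> ennreal ?\<epsilon> + ennreal ?K * ?A
        + interval_average Y (Y t) (lo (Suc n)) (hi (Suc n))"
    proof -
      have "{lo n..hi n} \<times> {lo n..hi n} \<subseteq> {0..T} \<times> {0..T}"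
        using t[of n] by auto
      moreover have "{0..T} \<times> {0..T} \<in> sets (borel :: (real \<times> real) measure)"
        by (intro borel_Times) auto
      moreover have "lo (Suc n) < hi (Suc n)" "0 < ?\<epsilon>"
        using h(1,2)[of "Suc n"] h(2)[of n] assms by auto
      ultimately show ?thesis
        using interval_average_step[of Y p "1 + \<alpha> * p" ?\<epsilon> "lo n" "lo (Suc n)" "hi (Suc n)" "hi n" "{0..T} \<times> {0..T}" "Y t"]
          assms(1,2) nest[of n] \<open>0 < 1 + \<alpha> * p\<close> unfolding h(1) by simp
    qed
    also have "?A \<le> ennreal (B powr p)"
      using A assms by (simp add: sobolev_seminorm_def ennpowr_inverse)
    then have "ennreal ?K * ?A \<le> ennreal ?K * ennreal (B powr p)"
      by (rule mult_left_mono) simp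
    also have "\<dots> = ennreal (?K * B powr p)"
      using h[of n] h[of "Suc n"] by (intro ennreal_mult[symmetric]) auto
    \<comment> \<open>The powers of B combine to B and those of \<open>h n\<close> to 2 + \<beta>;
      dividing by \<open>h n * h (Suc n)\<close>, half the square of \<open>h n\<close>, leaves the
      factor 2.\<close>
    also have "?K * B powr p = 2 * ?\<epsilon>"
    proof -
      have "\<beta> * (1 - p) + (1 + \<alpha> * p) = 2 + \<beta>"
        using assms by (simp add: \<beta>_def field_simps)
      then have "(h n powr \<beta>) powr (1 - p) * (h n) powr (1 + \<alpha> * p) = h n powr (2 + \<beta>)"
        by (simp only: powr_powr powr_add[symmetric])
      also have "\<dots> = h n * h n * h n powr \<beta>"
        using h[of n] by (simp add: powr_add power2_eq_square)
      finally have 1: "(h n powr \<beta>) powr (1 - p) * (h n) powr (1 + \<alpha> * p) = h n * h n * h n powr \<beta>" .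
      have 2: "B powr (1 - p) * B powr p = B"
        using assms by (simp add: powr_add[symmetric])
      have "?K * B powr p = (B powr (1 - p) * B powr p) * ((h n powr \<beta>) powr (1 - p) * (h n) powr (1 + \<alpha> * p)) / (h n * h (Suc n))"
        using assms by (simp add: powr_mult)
      also have "\<dots> = 2 * ?\<epsilon>"
        unfolding 1 2 h(3) using h(2)[of n] by simp
      finally show ?thesis .
    qed
    finally have "interval_average Y (Y t) (lo n) (hi n) \<le> ennreal ?\<epsilon> + ennreal (2 * ?\<epsilon>)
        + interval_average Y (Y t) (lo (Suc n)) (hi (Suc n))"
      by simp
    also have "ennreal ?\<epsilon> + ennreal (2 * ?\<epsilon>) = ennreal (3 * B * T powr \<beta> * r ^ n)"
      using assms r by (subst ennreal_plus[symmetric]) (auto simp: h_powr mult_ac)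
    finally show ?thesis .
  qed
  have iter: "interval_average Y (Y t) (lo 0) (hi 0)
      \<le> ennreal (\<Sum>n<N. 3 * B * T powr \<beta> * r ^ n) + interval_average Y (Y t) (lo N) (hi N)" for N
  proof (induction N)
    case (Suc N)
    note Suc
    also have "ennreal (\<Sum>n<N. 3 * B * T powr \<beta> * r ^ n) + interval_average Y (Y t) (lo N) (hi N)
      \<le> ennreal (\<Sum>n<N. 3 * B * T powr \<beta> * r ^ n) + (ennreal (3 * B * T powr \<beta> * r ^ N) + interval_average Y (Y t) (lo (Suc N)) (hi (Suc N)))"
      by (intro add_left_mono step)
    also have "\<dots> = ennreal (\<Sum>n<Suc N. 3 * B * T powr \<beta> * r ^ n) + interval_average Y (Y t) (lo (Suc N)) (hi (Suc N))"
      using assms r by (simp add: sum_nonneg add.assoc)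
    finally show ?case .
  qed simp
  \<comment> \<open>After finitely many steps one average is left over; continuity at t makes it at
    most e, which is the slack allowed from the start.\<close>
  obtain \<delta> where \<delta>: "0 < \<delta>" "\<And>u. dist u t < \<delta> \<Longrightarrow> dist (Y u) (Y t) < e"
    using \<open>0 < e\<close> assms(1) by (metis UNIV_I continuous_on_iff)
  have "(\<lambda>n. h n) \<longlonglongrightarrow> 0" unfolding h_def by real_asymp
  then have "\<forall>\<^sub>F n in sequentially. h n < \<delta>"
    using \<delta>(1) by (rule order_tendstoD)
  then obtain N where N: "h N < \<delta>"
    by (auto simp: eventually_sequentially)
  have "interval_average Y (Y t) (lo N) (hi N) \<le> ennreal e"
  proof (rule interval_average_le)
    show "dist (Y u) (Y t) \<le> e" if "u \<in> {lo N..hi N}" for u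
    proof -
      have "dist u t < \<delta>"
        using that N h(1)[of N] t(1,2)[of N] by (simp add: dist_real_def abs_less_iff)
      then show ?thesis using \<delta>(2) by (auto intro: less_imp_le)
    qed
  qed (use h[of N] \<open>0 < e\<close> in auto)
  then have "interval_average Y (Y t) 0 T \<le> ennreal (\<Sum>n<N. 3 * B * T powr \<beta> * r ^ n) + ennreal e"
    using iter[of N] by (auto simp: lo_def hi_def intro: order_trans add_left_mono)
  also have "ennreal (\<Sum>n<N. 3 * B * T powr \<beta> * r ^ n)
      \<le> ennreal (3 * T powr (\<alpha> - 1 / p) / (1 - 2 powr - (\<alpha> - 1 / p)) * B)"
  proof (rule ennreal_leI)
    have "(\<Sum>n<N. 3 * B * T powr \<beta> * r ^ n) = 3 * B * T powr \<beta> * (\<Sum>n<N. r ^ n)"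
      by (simp add: sum_distrib_left)
    also have "(\<Sum>n<N. r ^ n) \<le> (\<Sum>n. r ^ n)"
      using r by (intro sum_le_suminf) (auto intro: summable_geometric)
    also have "(\<Sum>n. r ^ n) = 1 / (1 - r)"
      using r by (intro suminf_geometric) auto
    finally show "(\<Sum>n<N. 3 * B * T powr \<beta> * r ^ n)
        \<le> 3 * T powr (\<alpha> - 1 / p) / (1 - 2 powr - (\<alpha> - 1 / p)) * B"
      using assms by (simp add: r_def \<beta>_def mult_left_mono mult_ac)
  qed
  finally show "interval_average Y (Y t) 0 T
      \<le> ennreal (3 * T powr (\<alpha> - 1 / p) / (1 - 2 powr - (\<alpha> - 1 / p)) * B) + ennreal e"
    by (simp add: add_right_mono)
qed

text \<open>The distance from \<open>X 0\<close> to \<open>X t\<close> is at most the mean over u of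
  the distances from \<open>X u\<close> to both. Each mean is controlled by
  \<open>interval_average_bound\<close>, hence the constant 6 = 2 * 3.\<close>

lemma sobolev_sup_bound:
  fixes X :: "real \<Rightarrow> 'a::metric_space" and T :: real
  assumes "1 < p" "1 / p < \<alpha>" "0 < T" "0 < B" "continuous_on {0..T} X" "t \<in> {0..T}"
    and "ennpowr (sobolev_seminorm \<alpha> p T dist X) p \<le> ennreal (B powr p)"
  shows "dist (X 0) (X t) \<le> 6 * T powr (\<alpha> - 1 / p) / (1 - 2 powr - (\<alpha> - 1 / p)) * B"
proof -
  define C where "C = 3 * T powr (\<alpha> - 1 / p) / (1 - 2 powr - (\<alpha> - 1 / p)) * B"
  \<comment> \<open>Clamping extends the path continuously to the whole line, as the averaging
    lemmas require, and leaves the seminorm unchanged.\<close>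
  define Y where "Y s = X (max 0 (min T s))" for s
  have Y: "continuous_on UNIV Y"
    unfolding Y_def using assms(3) by (intro continuous_on_compose2[OF assms(5)] continuous_intros) auto
  have Y_eq: "Y s = X s" if "s \<in> {0..T}" for s
    using that by (simp add: Y_def)
  have "sobolev_seminorm \<alpha> p T dist Y = sobolev_seminorm \<alpha> p T dist X"
    unfolding sobolev_seminorm_def
    by (rule arg_cong2[where f = ennpowr], rule nn_integral_cong) (auto simp: Y_eq indicator_def)
  then have avg: "interval_average Y (Y s) 0 T \<le> ennreal C" if "s \<in> {0..T}" for s
    unfolding C_def using assms Y that by (intro interval_average_bound) auto
  have [measurable]: "(\<lambda>u. dist (Y u) y) \<in> borel_measurable borel" for y
    by (intro borel_measurable_continuous_onI continuous_intros Y)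
  have "2 powr - (\<alpha> - 1 / p) \<le> (2::real) powr 0"
    using assms by (intro powr_mono) auto
  then have "0 \<le> C" using assms by (simp add: C_def)
  \<comment> \<open>A constant equals its own average over [0,T]; the triangle inequality is then
    applied under the integral.\<close>
  have "ennreal (dist (X 0) (X t)) = ennreal (1 / T) * (\<integral>\<^sup>+ u\<in>{0..T}. ennreal (dist (Y 0) (Y t)) \<partial>lborel)"
    using assms by (simp add: nn_integral_cmult_indicator Y_eq ennreal_mult[symmetric])
  also have "\<dots> \<le> ennreal (1 / T) * (\<integral>\<^sup>+ u. ennreal (dist (Y u) (Y 0)) * indicator {0..T} u
      + ennreal (dist (Y u) (Y t)) * indicator {0..T} u \<partial>lborel)"
    using dist_triangle3[of "Y 0" "Y t"]
    by (intro mult_left_mono nn_integral_mono) (auto simp: indicator_def ennreal_plus[symmetric] simp del: ennreal_plus intro!: ennreal_leI)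
  also have "\<dots> = interval_average Y (Y 0) 0 T + interval_average Y (Y t) 0 T"
    by (simp add: nn_integral_add interval_average_def distrib_left)
  also have "\<dots> \<le> ennreal C + ennreal C"
    using assms by (intro add_mono avg) auto
  also have "ennreal C + ennreal C = ennreal (C + C)"
    using \<open>0 \<le> C\<close> by (intro ennreal_plus[symmetric])
  finally have "dist (X 0) (X t) \<le> C + C"
    using \<open>0 \<le> C\<close> by (subst (asm) ennreal_le_iff) auto
  then show ?thesis by (simp add: C_def mult_ac)
qed

subsection \<open>Continuity of the marginal curve\<close>

lemma measurable_path_eval_prob:
  fixes \<pi> :: "(real \<Rightarrow> 'a::metric_space) measure"
  assumes "\<pi> \<in> space (prob_algebra (path_borel T))" "t \<in> {0..T}"
  shows "(\<lambda>\<gamma>. \<gamma> t) \<in> \<pi> \<rightarrow>\<^sub>M borel"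
proof -
  have "sets \<pi> = sets (path_borel T)"
    using assms(1) by (simp add: space_prob_algebra)
  then show ?thesis
    using measurable_path_eval[OF assms(2)] by (simp cong: measurable_cong_sets)
qed

lemma wasserstein_dist_marginal_curve_le:
  fixes \<pi> :: "(real \<Rightarrow> 'a::{metric_space, second_countable_topology}) measure"
  assumes "0 < p" and \<pi>: "\<pi> \<in> space (prob_algebra (path_borel T))" and "s \<in> {0..T}" "t \<in> {0..T}"
  shows "ennreal (wasserstein_dist p (marginal_curve \<pi> s) (marginal_curve \<pi> t) powr p)
      \<le> (\<integral>\<^sup>+ \<gamma>. ennreal (dist (\<gamma> s) (\<gamma> t) powr p) \<partial>\<pi>)"
proof -
  interpret prob_space \<pi> using \<pi> by (simp add: space_prob_algebra)
  note [measurable] = measurable_path_eval_prob[OF \<pi> assms(3)] measurable_path_eval_prob[OF \<pi> assms(4)]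
  have [measurable]: "fst \<in> borel_measurable (borel :: ('a \<times> 'a) measure)"
      "snd \<in> borel_measurable (borel :: ('a \<times> 'a) measure)"
    by (intro borel_measurable_continuous_onI continuous_intros)+
  \<comment> \<open>Second countability makes the pair map measurable into the Borel sets of the
    product, the space on which \<open>couplings\<close> lives.\<close>
  let ?\<sigma> = "distr \<pi> borel (\<lambda>\<gamma>. (\<gamma> s, \<gamma> t))"
  have "prob_space ?\<sigma>"
    by (rule prob_space_distr) measurable
  then have "?\<sigma> \<in> couplings (marginal_curve \<pi> s) (marginal_curve \<pi> t)"
    by (simp add: couplings_def marginal_curve_def space_prob_algebra distr_distr comp_def)
  from wasserstein_dist_powr_le[OF assms(1) this] show ?thesis
    by (simp add: nn_integral_distr)
qed

section \<open>Integrable majorants and dominated convergence\<close>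

lemma add_powr_le:
  fixes x y p :: real
  assumes "0 \<le> x" "0 \<le> y" "0 < p"
  shows "(x + y) powr p \<le> 2 powr p * (x powr p + y powr p)"
proof -
  have "(x + y) powr p \<le> (2 * max x y) powr p"
    using assms by (intro powr_mono2) auto
  also have "\<dots> = 2 powr p * max x y powr p"
    using assms by (simp add: powr_mult)
  also have "max x y powr p \<le> x powr p + y powr p"
    by (simp add: max_def)
  finally show ?thesis by simp
qed

text \<open>Turns a supremum bound stated for finite levels B into a majorant affine in
  \<open>N\<close>, valid also where \<open>N\<close> is infinite: the positive constant
  \<open>1 + \<bar>C\<bar>\<close> makes the right side infinite there.\<close>

lemma powr_le_of_linear_bound:
  fixes N :: ennreal and d C p :: real
  assumes "0 < p" "0 \<le> d" "\<And>B. 0 < B \<Longrightarrow> N \<le> ennreal (B powr p) \<Longrightarrow> d \<le> C * B"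
  shows "ennreal (d powr p) \<le> ennreal ((1 + \<bar>C\<bar>) powr p) * (1 + N)"
proof (cases N)
  case top
  then show ?thesis by (simp add: ennreal_mult_top)
next
  case (real n)
  \<comment> \<open>\<open>1 + n\<close> instead of \<open>n\<close> keeps \<open>B\<close> positive; \<open>\<pi>\<close> being finite, the extra \<open>1\<close> is integrable.\<close>
  define B where "B = (1 + n) powr (1 / p)"
  have B: "0 < B" "B powr p = 1 + n"
    using real assms by (auto simp: B_def powr_powr)
  then have "d \<le> C * B"
    using real by (intro assms(3)) auto
  also have "\<dots> \<le> (1 + \<bar>C\<bar>) * B"
    using B by (intro mult_right_mono) auto
  finally have "d powr p \<le> ((1 + \<bar>C\<bar>) * B) powr p"
    using assms by (intro powr_mono2) auto
  also have "\<dots> = (1 + \<bar>C\<bar>) powr p * (1 + n)"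
    using B by (simp add: powr_mult)
  finally have "ennreal (d powr p) \<le> ennreal ((1 + \<bar>C\<bar>) powr p * (1 + n))"
    by (rule ennreal_leI)
  also have "\<dots> = ennreal ((1 + \<bar>C\<bar>) powr p) * (1 + N)"
    using real by (simp add: ennreal_mult flip: ennreal_1)
  finally show ?thesis .
qed

text \<open>Serves both cases, with \<open>N\<close> the p-th power of either seminorm: continuity
  uses only its measurability, its integrability and its linear control of the distance from
  \<open>\<gamma> 0\<close>.\<close>

lemma continuous_path_marginal_curve:
  fixes \<pi> :: "(real \<Rightarrow> 'a::{metric_space, second_countable_topology}) measure"
    and N :: "(real \<Rightarrow> 'a) \<Rightarrow> ennreal"
  assumes "0 < p" "0 \<le> T" and \<pi>: "\<pi> \<in> space (prob_algebra (path_borel T))"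
    and N[measurable]: "N \<in> borel_measurable \<pi>"
    and fin: "(\<integral>\<^sup>+ \<gamma>. ennreal (dist (\<gamma> 0) xbar powr p) + N \<gamma> \<partial>\<pi>) < \<top>"
    and bound: "\<And>\<gamma> t B. continuous_on {0..T} \<gamma> \<Longrightarrow> t \<in> {0..T} \<Longrightarrow> 0 < B \<Longrightarrow>
      N \<gamma> \<le> ennreal (B powr p) \<Longrightarrow> dist (\<gamma> 0) (\<gamma> t) \<le> C * B"
  shows "continuous_path T (wasserstein_space p) (wasserstein_dist p) (marginal_curve \<pi>)"
proof -
  interpret prob_space \<pi> using \<pi> by (simp add: space_prob_algebra)
  have sets_\<pi>: "sets \<pi> = sets (path_borel T)"
    using \<pi> by (simp add: space_prob_algebra)
  note eval[measurable] = measurable_path_eval_prob[OF \<pi>]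
  have eval0[measurable]: "(\<lambda>\<gamma>. \<gamma> 0) \<in> borel_measurable \<pi>"
    using assms(2) by (intro eval) auto
  have cont: "continuous_on {0..T} \<gamma>" if "\<gamma> \<in> space \<pi>" for \<gamma>
    using that sets_eq_imp_space_eq[OF sets_\<pi>] by (auto intro: continuous_on_path)
  define K where "K = ennreal ((1 + \<bar>C\<bar>) powr p)"
  have from0: "ennreal (dist (\<gamma> 0) (\<gamma> t) powr p) \<le> K * (1 + N \<gamma>)" if "\<gamma> \<in> space \<pi>" "t \<in> {0..T}" for \<gamma> t
    unfolding K_def using assms(1) cont bound that by (intro powr_le_of_linear_bound) auto
  have ennreal_add_powr: "ennreal (c powr p) \<le> ennreal (2 powr p) * (ennreal (a powr p) + ennreal (b powr p))"
    if "0 \<le> a" "0 \<le> b" "0 \<le> c" "c \<le> a + b" for a b c :: real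
  proof -
    have "c powr p \<le> (a + b) powr p"
      using that assms(1) by (intro powr_mono2) auto
    also have "\<dots> \<le> 2 powr p * (a powr p + b powr p)"
      using that assms(1) by (intro add_powr_le)
    finally have "ennreal (c powr p) \<le> ennreal (2 powr p * (a powr p + b powr p))"
      by (rule ennreal_leI)
    then show ?thesis by (simp add: ennreal_mult)
  qed
  have "(\<integral>\<^sup>+ \<gamma>. N \<gamma> \<partial>\<pi>) \<le> (\<integral>\<^sup>+ \<gamma>. ennreal (dist (\<gamma> 0) xbar powr p) + N \<gamma> \<partial>\<pi>)"
    by (intro nn_integral_mono) simp
  then have fin_N: "(\<integral>\<^sup>+ \<gamma>. K * (1 + N \<gamma>) \<partial>\<pi>) < \<top>"
    using fin by (simp add: nn_integral_cmult nn_integral_add emeasure_space_1 K_def ennreal_mult_less_top)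
  have "(\<integral>\<^sup>+ \<gamma>. ennreal (dist (\<gamma> 0) xbar powr p) \<partial>\<pi>) \<le> (\<integral>\<^sup>+ \<gamma>. ennreal (dist (\<gamma> 0) xbar powr p) + N \<gamma> \<partial>\<pi>)"
    by (intro nn_integral_mono) simp
  then have fin_0: "(\<integral>\<^sup>+ \<gamma>. ennreal (dist (\<gamma> 0) xbar powr p) \<partial>\<pi>) < \<top>"
    using fin by simp
  have mem: "marginal_curve \<pi> t \<in> wasserstein_space p" if t: "t \<in> {0..T}" for t
  proof -
    note [measurable] = eval[OF t]
    have "prob_space (marginal_curve \<pi> t)"
      unfolding marginal_curve_def by (rule prob_space_distr) measurable
    moreover have "(\<integral>\<^sup>+ x. ennreal (dist x xbar powr p) \<partial>marginal_curve \<pi> t) < \<top>"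
    proof -
      have "(\<integral>\<^sup>+ x. ennreal (dist x xbar powr p) \<partial>marginal_curve \<pi> t)
          = (\<integral>\<^sup>+ \<gamma>. ennreal (dist (\<gamma> t) xbar powr p) \<partial>\<pi>)"
        by (simp add: marginal_curve_def nn_integral_distr)
      also have "\<dots> \<le> (\<integral>\<^sup>+ \<gamma>. ennreal (2 powr p) * (ennreal (dist (\<gamma> 0) xbar powr p) + K * (1 + N \<gamma>)) \<partial>\<pi>)"
      proof (rule nn_integral_mono)
        fix \<gamma> assume \<gamma>: "\<gamma> \<in> space \<pi>"
        have "ennreal (dist (\<gamma> t) xbar powr p)
            \<le> ennreal (2 powr p) * (ennreal (dist (\<gamma> 0) xbar powr p) + ennreal (dist (\<gamma> 0) (\<gamma> t) powr p))"
          using dist_triangle3[of "\<gamma> t" xbar "\<gamma> 0"] by (intro ennreal_add_powr) auto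
        also have "\<dots> \<le> ennreal (2 powr p) * (ennreal (dist (\<gamma> 0) xbar powr p) + K * (1 + N \<gamma>))"
          by (intro mult_left_mono add_left_mono from0 \<gamma> t) simp
        finally show "ennreal (dist (\<gamma> t) xbar powr p)
            \<le> ennreal (2 powr p) * (ennreal (dist (\<gamma> 0) xbar powr p) + K * (1 + N \<gamma>))" .
      qed
      also have "\<dots> = ennreal (2 powr p) * ((\<integral>\<^sup>+ \<gamma>. ennreal (dist (\<gamma> 0) xbar powr p) \<partial>\<pi>) + (\<integral>\<^sup>+ \<gamma>. K * (1 + N \<gamma>) \<partial>\<pi>))"
        by (subst nn_integral_cmult, measurable) (subst nn_integral_add, auto)
      also have "\<dots> < \<top>"
        using fin_0 fin_N by (simp add: ennreal_mult_less_top)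
      finally show ?thesis .
    qed
    ultimately show ?thesis
      by (auto simp: wasserstein_space_def space_prob_algebra marginal_curve_def)
  qed
  have lim: "(\<lambda>n. \<integral>\<^sup>+ \<gamma>. ennreal (dist (\<gamma> (S n)) (\<gamma> t) powr p) \<partial>\<pi>) \<longlonglongrightarrow> 0"
    if t: "t \<in> {0..T}" and S: "\<And>n. S n \<in> {0..T}" "S \<longlonglongrightarrow> t" for t and S :: "nat \<Rightarrow> real"
  proof -
    note [measurable] = eval[OF t] eval[OF S(1)]
    \<comment> \<open>Comparing both \<open>\<gamma> (S n)\<close> and \<open>\<gamma> t\<close>
      with \<open>\<gamma> 0\<close> yields a majorant independent of n.\<close>
    let ?w = "\<lambda>\<gamma>. ennreal (2 powr p) * (K * (1 + N \<gamma>) + K * (1 + N \<gamma>))"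
    have "(\<lambda>n. \<integral>\<^sup>+ \<gamma>. ennreal (dist (\<gamma> (S n)) (\<gamma> t) powr p) \<partial>\<pi>) \<longlonglongrightarrow> (\<integral>\<^sup>+ \<gamma>. 0 \<partial>\<pi>)"
    proof (rule nn_integral_dominated_convergence[where w = ?w])
      show "AE \<gamma> in \<pi>. ennreal (dist (\<gamma> (S n)) (\<gamma> t) powr p) \<le> ?w \<gamma>" for n
      proof (rule AE_I2)
        fix \<gamma> assume \<gamma>: "\<gamma> \<in> space \<pi>"
        have "ennreal (dist (\<gamma> (S n)) (\<gamma> t) powr p)
            \<le> ennreal (2 powr p) * (ennreal (dist (\<gamma> 0) (\<gamma> (S n)) powr p) + ennreal (dist (\<gamma> 0) (\<gamma> t) powr p))"
          using dist_triangle3[of "\<gamma> (S n)" "\<gamma> t" "\<gamma> 0"] by (intro ennreal_add_powr) auto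
        also have "\<dots> \<le> ?w \<gamma>"
          by (intro mult_left_mono add_mono from0 \<gamma> t S(1)) simp
        finally show "ennreal (dist (\<gamma> (S n)) (\<gamma> t) powr p) \<le> ?w \<gamma>" .
      qed
      have "(\<integral>\<^sup>+ \<gamma>. ?w \<gamma> \<partial>\<pi>) = ennreal (2 powr p) * ((\<integral>\<^sup>+ \<gamma>. K * (1 + N \<gamma>) \<partial>\<pi>) + (\<integral>\<^sup>+ \<gamma>. K * (1 + N \<gamma>) \<partial>\<pi>))"
        by (subst nn_integral_cmult, measurable) (subst nn_integral_add, auto)
      also have "\<dots> < \<top>"
        using fin_N by (simp add: ennreal_mult_less_top)
      finally show "(\<integral>\<^sup>+ \<gamma>. ?w \<gamma> \<partial>\<pi>) < \<infinity>" by simp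
      show "AE \<gamma> in \<pi>. (\<lambda>n. ennreal (dist (\<gamma> (S n)) (\<gamma> t) powr p)) \<longlonglongrightarrow> 0"
      proof (rule AE_I2)
        fix \<gamma> assume \<gamma>: "\<gamma> \<in> space \<pi>"
        have "(\<lambda>n. \<gamma> (S n)) \<longlonglongrightarrow> \<gamma> t"
          using S t by (intro continuous_on_tendsto_compose[OF cont[OF \<gamma>]]) auto
        then have "(\<lambda>n. dist (\<gamma> (S n)) (\<gamma> t)) \<longlonglongrightarrow> 0"
          by (simp add: tendsto_dist_iff[symmetric])
        then have "(\<lambda>n. dist (\<gamma> (S n)) (\<gamma> t) powr p) \<longlonglongrightarrow> 0"
          using tendsto_powr2[of "\<lambda>n. dist (\<gamma> (S n)) (\<gamma> t)" 0 sequentially "\<lambda>_. p" p] assms(1) by auto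
        then show "(\<lambda>n. ennreal (dist (\<gamma> (S n)) (\<gamma> t) powr p)) \<longlonglongrightarrow> 0"
          using tendsto_ennrealI by fastforce
      qed
    qed auto
    then show ?thesis by simp
  qed
  show ?thesis
    unfolding continuous_path_def
  proof (intro conjI ballI allI impI mem)
    fix t \<epsilon> :: real assume t: "t \<in> {0..T}" and \<epsilon>: "0 < \<epsilon>"
    let ?f = "\<lambda>s. \<integral>\<^sup>+ \<gamma>. ennreal (dist (\<gamma> s) (\<gamma> t) powr p) \<partial>\<pi>"
    have "(?f \<longlongrightarrow> 0) (at t within {0..T})"
      unfolding tendsto_at_iff_sequentially comp_def using lim[OF t] by auto
    then have "\<forall>\<^sub>F s in at t within {0..T}. ?f s < ennreal (\<epsilon> powr p)"
      using \<epsilon> by (intro order_tendstoD) auto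
    then obtain \<delta> where \<delta>: "0 < \<delta>" "\<And>s. s \<in> {0..T} \<Longrightarrow> s \<noteq> t \<Longrightarrow> dist s t < \<delta> \<Longrightarrow> ?f s < ennreal (\<epsilon> powr p)"
      unfolding eventually_at by auto
    have "wasserstein_dist p (marginal_curve \<pi> s) (marginal_curve \<pi> t) < \<epsilon>"
      if s: "s \<in> {0..T}" "\<bar>s - t\<bar> < \<delta>" for s
    proof -
      \<comment> \<open>The limit controls only s different from t; at s = t the integrand
        vanishes.\<close>
      have "?f s < ennreal (\<epsilon> powr p)"
        using \<delta>(2)[of s] s \<epsilon> by (cases "s = t") (auto simp: dist_real_def)
      with wasserstein_dist_marginal_curve_le[OF assms(1) \<pi> s(1) t]
      have "ennreal (wasserstein_dist p (marginal_curve \<pi> s) (marginal_curve \<pi> t) powr p) < ennreal (\<epsilon> powr p)"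
        by (rule le_less_trans)
      then have "wasserstein_dist p (marginal_curve \<pi> s) (marginal_curve \<pi> t) powr p < \<epsilon> powr p"
        by (simp add: ennreal_less_iff)
      then show ?thesis
        using powr_mono2[of p \<epsilon> "wasserstein_dist p (marginal_curve \<pi> s) (marginal_curve \<pi> t)"] assms(1) \<epsilon>
        by (meson less_imp_le not_le)
    qed
    with \<delta>(1) show "\<exists>\<delta>>0. \<forall>s\<in>{0..T}. \<bar>s - t\<bar> < \<delta> \<longrightarrow> wasserstein_dist p (marginal_curve \<pi> s) (marginal_curve \<pi> t) < \<epsilon>"
      by blast
  qed
qed

subsection \<open>Seminorm inequalities\<close>

lemma ennpowr_sobolev_seminorm:
  assumes "0 < p"
  shows "ennpowr (sobolev_seminorm \<alpha> p T \<rho> X) p = (\<integral>\<^sup>+ z \<in> {0..T} \<times> {0..T}.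
      ennreal (\<rho> (X (fst z)) (X (snd z)) powr p / \<bar>snd z - fst z\<bar> powr (1 + \<alpha> * p)) \<partial>(lborel :: (real \<times> real) measure))"
  using assms by (simp add: sobolev_seminorm_def ennpowr_inverse)

lemma ennpowr_besov_seminorm:
  assumes "0 < p"
  shows "ennpowr (besov_seminorm \<alpha> p \<rho> X) p = (\<Sum>m. ennreal (2 powr (real m * (\<alpha> * p - 1))) *
      (\<Sum>k<2 ^ m. ennreal (\<rho> (X (real k / 2 ^ m)) (X (real (k + 1) / 2 ^ m)) powr p)))"
  using assms by (simp add: besov_seminorm_def ennpowr_inverse)

section \<open>Sobolev case: joint measurability and exchange of integrals\<close>

lemma sobolev_integrand_measurable:
  fixes \<pi> :: "(real \<Rightarrow> 'a::{metric_space, second_countable_topology}) measure"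
  assumes "0 < T" and \<pi>: "\<pi> \<in> space (prob_algebra (path_borel T))"
  shows "(\<lambda>(\<gamma>, z). ennreal (dist (\<gamma> (fst z)) (\<gamma> (snd z)) powr p / \<bar>snd z - fst z\<bar> powr (1 + \<alpha> * p))
      * indicator ({0..T} \<times> {0..T}) z) \<in> borel_measurable (\<pi> \<Otimes>\<^sub>M (lborel :: (real \<times> real) measure))"
proof -
  let ?M = "\<pi> \<Otimes>\<^sub>M (lborel :: (real \<times> real) measure)"
  let ?c = "\<lambda>s. max 0 (min T s)"
  have [measurable_cong]: "sets \<pi> = sets (path_borel T)"
    using \<pi> by (simp add: space_prob_algebra)
  have [measurable]: "fst \<in> borel_measurable (borel :: (real \<times> real) measure)"
      "snd \<in> borel_measurable (borel :: (real \<times> real) measure)"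
    by (intro borel_measurable_continuous_onI continuous_intros)+
  have [measurable]: "{0..T} \<times> {0..T} \<in> sets (borel :: (real \<times> real) measure)"
    by (intro borel_Times) auto
  have "(\<lambda>w. (fst w, fst (snd w))) \<in> ?M \<rightarrow>\<^sub>M path_borel T \<Otimes>\<^sub>M borel"
    "(\<lambda>w. (fst w, snd (snd w))) \<in> ?M \<rightarrow>\<^sub>M path_borel T \<Otimes>\<^sub>M borel"
    by measurable
  from this[THEN measurable_compose[OF _ measurable_path_eval_joint[OF assms(1)]]]
  have [measurable]: "(\<lambda>w. fst w (?c (fst (snd w)))) \<in> borel_measurable ?M"
    "(\<lambda>w. fst w (?c (snd (snd w)))) \<in> borel_measurable ?M"
    by simp_all
  have "(\<lambda>w. ennreal (dist (fst w (?c (fst (snd w)))) (fst w (?c (snd (snd w)))) powr p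
      / \<bar>snd (snd w) - fst (snd w)\<bar> powr (1 + \<alpha> * p)) * indicator ({0..T} \<times> {0..T}) (snd w)) \<in> borel_measurable ?M"
    by measurable
  \<comment> \<open>The indicator vanishes wherever clamping alters a time, so the two integrands
    agree.\<close>
  then show ?thesis
    by (rule measurable_cong[THEN iffD1, rotated]) (auto simp: indicator_def)
qed

lemma sobolev_seminorm_measurable:
  fixes \<pi> :: "(real \<Rightarrow> 'a::{metric_space, second_countable_topology}) measure"
  assumes "0 < p" "0 < T" "\<pi> \<in> space (prob_algebra (path_borel T))"
  shows "(\<lambda>\<gamma>. ennpowr (sobolev_seminorm \<alpha> p T dist \<gamma>) p) \<in> borel_measurable \<pi>"
  using lborel.borel_measurable_nn_integral[OF sobolev_integrand_measurable[OF assms(2,3)], of p \<alpha>]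
  by (simp add: ennpowr_sobolev_seminorm[OF assms(1)])

lemma sobolev_seminorm_marginal_curve_le:
  fixes \<pi> :: "(real \<Rightarrow> 'a::{metric_space, second_countable_topology}) measure"
  assumes "0 < p" "0 < T" and \<pi>: "\<pi> \<in> space (prob_algebra (path_borel T))"
  shows "ennpowr (sobolev_seminorm \<alpha> p T (wasserstein_dist p) (marginal_curve \<pi>)) p
      \<le> (\<integral>\<^sup>+ \<gamma>. ennpowr (sobolev_seminorm \<alpha> p T dist \<gamma>) p \<partial>\<pi>)"
proof -
  interpret prob_space \<pi> using \<pi> by (simp add: space_prob_algebra)
  interpret pair_sigma_finite \<pi> "lborel :: (real \<times> real) measure" ..
  let ?w = "\<lambda>z :: real \<times> real. \<bar>snd z - fst z\<bar> powr (1 + \<alpha> * p)"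
  let ?S = "{0..T} \<times> {0..T}"
  let ?W = "\<lambda>z. wasserstein_dist p (marginal_curve \<pi> (fst z)) (marginal_curve \<pi> (snd z)) powr p"
  have "(\<integral>\<^sup>+ z\<in>?S. ennreal (?W z / ?w z) \<partial>lborel)
      \<le> (\<integral>\<^sup>+ z. \<integral>\<^sup>+ \<gamma>. ennreal (dist (\<gamma> (fst z)) (\<gamma> (snd z)) powr p / ?w z) * indicator ?S z \<partial>\<pi> \<partial>lborel)"
  proof (rule nn_integral_mono)
    fix z :: "real \<times> real"
    show "ennreal (?W z / ?w z) * indicator ?S z
        \<le> (\<integral>\<^sup>+ \<gamma>. ennreal (dist (\<gamma> (fst z)) (\<gamma> (snd z)) powr p / ?w z) * indicator ?S z \<partial>\<pi>)"
    proof (cases "z \<in> ?S")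
      case True
      then have t: "fst z \<in> {0..T}" "snd z \<in> {0..T}" by auto
      note [measurable] = measurable_path_eval_prob[OF \<pi> t(1)] measurable_path_eval_prob[OF \<pi> t(2)]
      \<comment> \<open>This factorisation also holds on the diagonal, where \<open>?w z\<close> is
        0 and both sides are 0 by the convention for division.\<close>
      have "ennreal (?W z / ?w z) = ennreal (?W z) * ennreal (1 / ?w z)"
        by (simp add: ennreal_mult[symmetric])
      also have "\<dots> \<le> (\<integral>\<^sup>+ \<gamma>. ennreal (dist (\<gamma> (fst z)) (\<gamma> (snd z)) powr p) \<partial>\<pi>) * ennreal (1 / ?w z)"
        by (intro mult_right_mono wasserstein_dist_marginal_curve_le[OF assms(1) \<pi> t]) simp
      also have "\<dots> = (\<integral>\<^sup>+ \<gamma>. ennreal (dist (\<gamma> (fst z)) (\<gamma> (snd z)) powr p / ?w z) \<partial>\<pi>)"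
        by (subst nn_integral_multc[symmetric]) (auto simp: ennreal_mult[symmetric])
      finally show ?thesis using True by simp
    qed simp
  qed
  also have "\<dots> = (\<integral>\<^sup>+ \<gamma>. \<integral>\<^sup>+ z. ennreal (dist (\<gamma> (fst z)) (\<gamma> (snd z)) powr p / ?w z) * indicator ?S z \<partial>lborel \<partial>\<pi>)"
    by (rule Fubini'[OF sobolev_integrand_measurable[OF assms(2) \<pi>]])
  finally show ?thesis
    by (simp only: ennpowr_sobolev_seminorm[OF assms(1)])
qed

section \<open>Besov case: dyadic times and exchange of series and integral\<close>

lemma dyadic_points_in_unit_interval:
  assumes "k < 2 ^ m"
  shows "real k / 2 ^ m \<in> {0..1}" "real (k + 1) / 2 ^ m \<in> {0..1}"
proof -
  have "real (k + 1) \<le> 2 ^ m"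
    using assms by (metis Suc_eq_plus1 Suc_leI of_nat_le_iff of_nat_numeral of_nat_power)
  then show "real k / 2 ^ m \<in> {0..1}" "real (k + 1) / 2 ^ m \<in> {0..1}"
    using assms by (auto simp: divide_simps)
qed

lemma besov_term_measurable:
  fixes \<pi> :: "(real \<Rightarrow> 'a::{metric_space, second_countable_topology}) measure"
  assumes \<pi>: "\<pi> \<in> space (prob_algebra (path_borel 1))" and "k < 2 ^ m"
  shows "(\<lambda>\<gamma>. ennreal (dist (\<gamma> (real k / 2 ^ m)) (\<gamma> (real (k + 1) / 2 ^ m)) powr p)) \<in> borel_measurable \<pi>"
proof -
  note [measurable] = dyadic_points_in_unit_interval[OF assms(2), THEN measurable_path_eval_prob[OF \<pi>]]
  show ?thesis by measurable
qed

lemma besov_seminorm_measurable: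
  fixes \<pi> :: "(real \<Rightarrow> 'a::{metric_space, second_countable_topology}) measure"
  assumes "0 < p" "\<pi> \<in> space (prob_algebra (path_borel 1))"
  shows "(\<lambda>\<gamma>. ennpowr (besov_seminorm \<alpha> p dist \<gamma>) p) \<in> borel_measurable \<pi>"
  unfolding ennpowr_besov_seminorm[OF assms(1)]
  by (intro borel_measurable_suminf_order borel_measurable_times_ennreal borel_measurable_const
      borel_measurable_sum besov_term_measurable[OF assms(2)]) auto

text \<open>The coupling bound is applied to each dyadic increment; finite sums, weights and the
  series then move inside the integral, all terms being nonnegative.\<close>

lemma besov_seminorm_marginal_curve_le:
  fixes \<pi> :: "(real \<Rightarrow> 'a::{metric_space, second_countable_topology}) measure"
  assumes "0 < p" and \<pi>: "\<pi> \<in> space (prob_algebra (path_borel 1))"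
  shows "ennpowr (besov_seminorm \<alpha> p (wasserstein_dist p) (marginal_curve \<pi>)) p
      \<le> (\<integral>\<^sup>+ \<gamma>. ennpowr (besov_seminorm \<alpha> p dist \<gamma>) p \<partial>\<pi>)"
proof -
  let ?c = "\<lambda>m. ennreal (2 powr (real m * (\<alpha> * p - 1)))"
  let ?W = "\<lambda>m k. ennreal (wasserstein_dist p (marginal_curve \<pi> (real k / 2 ^ m)) (marginal_curve \<pi> (real (k + 1) / 2 ^ m)) powr p)"
  let ?D = "\<lambda>m k \<gamma>. ennreal (dist (\<gamma> (real k / 2 ^ m)) (\<gamma> (real (k + 1) / 2 ^ m)) powr p)"
  have [measurable]: "(\<lambda>\<gamma>. \<Sum>k<2 ^ m. ?D m k \<gamma>) \<in> borel_measurable \<pi>" for m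
    by (intro borel_measurable_sum besov_term_measurable[OF \<pi>]) auto
  have "(\<Sum>m. ?c m * (\<Sum>k<2 ^ m. ?W m k)) \<le> (\<Sum>m. ?c m * (\<Sum>k<2 ^ m. \<integral>\<^sup>+ \<gamma>. ?D m k \<gamma> \<partial>\<pi>))"
    by (intro suminf_le mult_left_mono sum_mono wasserstein_dist_marginal_curve_le[OF assms(1) \<pi>]
        dyadic_points_in_unit_interval) auto
  also have "\<dots> = (\<Sum>m. ?c m * (\<integral>\<^sup>+ \<gamma>. (\<Sum>k<2 ^ m. ?D m k \<gamma>) \<partial>\<pi>))"
    by (subst nn_integral_sum) (rule besov_term_measurable[OF \<pi>], simp_all)
  also have "\<dots> = (\<Sum>m. \<integral>\<^sup>+ \<gamma>. ?c m * (\<Sum>k<2 ^ m. ?D m k \<gamma>) \<partial>\<pi>)"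
    by (intro suminf_cong nn_integral_cmult[symmetric]) measurable
  also have "\<dots> = (\<integral>\<^sup>+ \<gamma>. (\<Sum>m. ?c m * (\<Sum>k<2 ^ m. ?D m k \<gamma>)) \<partial>\<pi>)"
    by (intro nn_integral_suminf[symmetric]) measurable
  finally show ?thesis
    by (simp only: ennpowr_besov_seminorm[OF assms(1)])
qed

lemma ennpowr_nn_integral_less_top:
  assumes "ennpowr x p \<le> (\<integral>\<^sup>+ \<gamma>. N \<gamma> \<partial>\<pi>)" "(\<integral>\<^sup>+ \<gamma>. f \<gamma> + N \<gamma> \<partial>\<pi>) < \<top>"
  shows "x < \<top>"
proof -
  have "(\<integral>\<^sup>+ \<gamma>. N \<gamma> \<partial>\<pi>) \<le> (\<integral>\<^sup>+ \<gamma>. f \<gamma> + N \<gamma> \<partial>\<pi>)"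
    by (intro nn_integral_mono) simp
  with assms have "ennpowr x p < \<top>" by (blast intro: le_less_trans)
  then show ?thesis by (simp add: ennpowr_less_top_iff)
qed

theorem theorem1p2:
  fixes xbar :: "'a::polish_space" and p \<alpha> :: real
  assumes "1 < p" and "1 / p < \<alpha>" and "\<alpha> < 1"
  shows
    "(\<forall>T>0. \<forall>\<pi> \<in> space (prob_algebra (path_borel T :: (real \<Rightarrow> 'a) measure)).
        (\<integral>\<^sup>+ \<gamma>. (ennreal (dist (\<gamma> 0) xbar powr p)
                 + ennpowr (sobolev_seminorm \<alpha> p T dist \<gamma>) p) \<partial>\<pi>) < \<top> \<longrightarrow>
        marginal_curve \<pi> \<in> sobolev_paths \<alpha> p T (wasserstein_space p) (wasserstein_dist p) \<and>
        ennpowr (sobolev_seminorm \<alpha> p T (wasserstein_dist p) (marginal_curve \<pi>)) p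
          \<le> (\<integral>\<^sup>+ \<gamma>. ennpowr (sobolev_seminorm \<alpha> p T dist \<gamma>) p \<partial>\<pi>))
     \<and>
     (\<forall>\<pi> \<in> space (prob_algebra (path_borel 1 :: (real \<Rightarrow> 'a) measure)).
        (\<integral>\<^sup>+ \<gamma>. (ennreal (dist (\<gamma> 0) xbar powr p)
                 + ennpowr (besov_seminorm \<alpha> p dist \<gamma>) p) \<partial>\<pi>) < \<top> \<longrightarrow>
        marginal_curve \<pi> \<in> besov_paths \<alpha> p (wasserstein_space p) (wasserstein_dist p) \<and>
        ennpowr (besov_seminorm \<alpha> p (wasserstein_dist p) (marginal_curve \<pi>)) p
          \<le> (\<integral>\<^sup>+ \<gamma>. ennpowr (besov_seminorm \<alpha> p dist \<gamma>) p \<partial>\<pi>))"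
proof (intro conjI allI ballI impI)
  have p: "0 < p" using assms by simp
  fix T :: real and \<pi> :: "(real \<Rightarrow> 'a) measure"
  assume T: "0 < T" and \<pi>: "\<pi> \<in> space (prob_algebra (path_borel T))"
    and fin: "(\<integral>\<^sup>+ \<gamma>. (ennreal (dist (\<gamma> 0) xbar powr p)
                 + ennpowr (sobolev_seminorm \<alpha> p T dist \<gamma>) p) \<partial>\<pi>) < \<top>"
  \<comment> \<open>The inequality comes first because, with the integrability hypothesis, it also
    yields the finite seminorm that membership demands.\<close>
  show le: "ennpowr (sobolev_seminorm \<alpha> p T (wasserstein_dist p) (marginal_curve \<pi>)) p
          \<le> (\<integral>\<^sup>+ \<gamma>. ennpowr (sobolev_seminorm \<alpha> p T dist \<gamma>) p \<partial>\<pi>)"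
    by (rule sobolev_seminorm_marginal_curve_le[OF p T \<pi>])
  have "continuous_path T (wasserstein_space p) (wasserstein_dist p) (marginal_curve \<pi>)"
    by (rule continuous_path_marginal_curve[OF p less_imp_le[OF T] \<pi>
          sobolev_seminorm_measurable[OF p T \<pi>] fin sobolev_sup_bound[OF assms(1,2) T]])
  then show "marginal_curve \<pi> \<in> sobolev_paths \<alpha> p T (wasserstein_space p) (wasserstein_dist p)"
    using ennpowr_nn_integral_less_top[OF le fin] by (simp add: sobolev_paths_def)
next
  have p: "0 < p" using assms by simp
  fix \<pi> :: "(real \<Rightarrow> 'a) measure"
  assume \<pi>: "\<pi> \<in> space (prob_algebra (path_borel 1))"
    and fin: "(\<integral>\<^sup>+ \<gamma>. (ennreal (dist (\<gamma> 0) xbar powr p)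
                 + ennpowr (besov_seminorm \<alpha> p dist \<gamma>) p) \<partial>\<pi>) < \<top>"
  show le: "ennpowr (besov_seminorm \<alpha> p (wasserstein_dist p) (marginal_curve \<pi>)) p
          \<le> (\<integral>\<^sup>+ \<gamma>. ennpowr (besov_seminorm \<alpha> p dist \<gamma>) p \<partial>\<pi>)"
    by (rule besov_seminorm_marginal_curve_le[OF p \<pi>])
  have "continuous_path 1 (wasserstein_space p) (wasserstein_dist p) (marginal_curve \<pi>)"
    by (rule continuous_path_marginal_curve[OF p zero_le_one \<pi>
          besov_seminorm_measurable[OF p \<pi>] fin besov_sup_bound[OF assms(1,2)]])
  then show "marginal_curve \<pi> \<in> besov_paths \<alpha> p (wasserstein_space p) (wasserstein_dist p)"
    using ennpowr_nn_integral_less_top[OF le fin] by (simp add: besov_paths_def)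
qed

end
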